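(* Let $f\in\mathcal F_{m,L}$ with minimizer $x^\star$, let $A\in\mathbb R^{n\times n}$, $B\in\mathbb R^{n\times d}$, $C,E\in\mathbb R^{d\times n}$ ($d\le n$), and consider the random iteration, for $k=0,1,2,\dots$, started at a deterministic $\xi_0\in\mathbb R^n$, $$\xi_{k+1}=A\xi_k+B\tilde u_k,\qquad \tilde u_k=\widehat\nabla f(y_k),\qquad y_k=C\xi_k,\qquad x_k=E\xi_k,$$ where $\widehat\nabla f$ is an unbiased random estimator of $\nabla f$ whose randomness at step $k$ is independent of the current state (see context), and with $\xi^\star\in\mathbb R^n$ satisfying $A\xi^\star=\xi^\star$, $C\xi^\star=E\xi^\star=x^\star$. Suppose that there exist $a_0>0$, $\rho\in(0,1)$, a symmetric matrix $P\in\mathbb R^{n\times n}$ with $\widetilde P:=P+\frac{a_0m}2E^{T}E\succ0$, and $\rho_0>1$, such that for all $y\in\mathbb R^d$ $$\mathbb E\big[\widehat\nabla f(y)^{T}(EB)^{T}(EB)\widehat\nabla f(y)\big]\le\rho_0\nabla f(y)^{T}(EB)^{T}(EB)\nabla f(y),$$ $$\mathbb E\big[\widehat\nabla f(y)^{T}B^{T}PB\,\widehat\nabla f(y)\big]\le\rho_0\nabla f(y)^{T}B^{T}PB\,\nabla f(y),$$ and $$T=M^{(0)}+a_0\rho^2M^{(1)}+a_0(1-\rho^2)M^{(2)}\preceq0,$$ where $$M^{(0)}=\begin{bmatrix}A^{T}PA-\rho^2P&A^{T}PB\\ B^{T}PA&\rho_0B^{T}PB\end{bmatrix},\qquad M^{(1)}=N^{(1)}+N^{(2)},\quad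 M^{(2)}=N^{(1)}+N^{(3)},$$ with $$N^{(1)}=\begin{bmatrix}\frac L2(EA-C)^{T}(EA-C)&\frac12(EA-C)^{T}(L\,EB+I_d)\\ \frac12(L\,EB+I_d)^{T}(EA-C)&\frac{L\rho_0}{2}(EB)^{T}EB+\frac12\big(EB+(EB)^{T}\big)\end{bmatrix},$$ $$N^{(2)}=\begin{bmatrix}C-E&0\\0&I_d\end{bmatrix}^{T}\begin{bmatrix}-\frac m2I_d&\frac12I_d\\ \frac12I_d&0\end{bmatrix}\begin{bmatrix}C-E&0\\0&I_d\end{bmatrix},$$ $$N^{(3)}=\begin{bmatrix}C^{T}&0\\0&I_d\end{bmatrix}\begin{bmatrix}-\frac m2I_d&\frac12I_d\\ \frac12I_d&0\end{bmatrix}\begin{bmatrix}C&0\\0&I_d\end{bmatrix}.$$ Then, for all $k\ge0$, $$\mathbb E\big[\|x_k-x^\star\|^2\big]\le\lambda_{\max}(E^{T}E)\,\mathbb E\big[\|\xi_k-\xi^\star\|^2\big]\le\frac{\lambda_{\max}(E^{T}E)}{\lambda_{\min}(\widetilde P)}\,V_0(\xi_0)\,\rho^{2k},$$ where, with $x=E\xi$, $$V_k(\xi)=\rho^{-2k}\Big(a_0\big(f(x)-f(x^\star)\big)+(\xi-\xi^\star)^{T}P(\xi-\xi^\star)\Big).$$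
   Context: For $0<m\le L$, $\mathcal F_{m,L}$ denotes the set of differentiable functions $f:\mathbb R^d\to\mathbb R$ that are $m$-strongly convex and have $L$-Lipschitz gradient. The random gradient has the form $\widehat\nabla f(y)=\nabla f(y,z)$, where $z$ is a random variable (gradient noise) with $\mathbb E[\nabla f(y,z)]=\nabla f(y)$ for every $y\in\mathbb R^d$. At step $k$ of the iteration, $\widehat\nabla f(y_k)=\nabla f(y_k,z_k)$ with $z_k$ a realization of the noise that is independent of the current state $\xi_k$ (and hence of $y_k$). $I_d$ is the $d\times d$ identity, $\|\cdot\|$ is the Euclidean norm, $\lambda_{\max}(\cdot)$, $\lambda_{\min}(\cdot)$ denote the largest and smallest eigenvalue of a symmetric matrix, and $X\succ0$ (resp. $X\preceq0$) means that the symmetric matrix $X$ is positive definite (resp. negative semidefinite). *)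

theory Defs
  imports "HOL-Probability.Probability"
begin

section \<open>Strongly convex functions with Lipschitz gradient\<close>

definition grad :: "('a::real_inner \<Rightarrow> real) \<Rightarrow> 'a \<Rightarrow> 'a" where
  "grad f x = (THE D. GDERIV f x :> D)"

definition strongly_convex :: "real \<Rightarrow> ('a::real_inner \<Rightarrow> real) \<Rightarrow> bool" where
  "strongly_convex m f \<longleftrightarrow>
     (\<forall>x y t. 0 \<le> t \<longrightarrow> t \<le> 1 \<longrightarrow>
        f (t *\<^sub>R x + (1 - t) *\<^sub>R y)
          \<le> t * f x + (1 - t) * f y - m / 2 * t * (1 - t) * (norm (x - y))\<^sup>2)"

definition smooth_strongly_convex :: "real \<Rightarrow> real \<Rightarrow> ('a::real_inner \<Rightarrow> real) set" where
  "smooth_strongly_convex m L =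
     {f. (\<forall>x. f differentiable (at x)) \<and> strongly_convex m f \<and> L-lipschitz_on UNIV (grad f)}"


section \<open>Matrices\<close>

definition qform :: "real ^ 'a ^ 'a \<Rightarrow> real ^ 'a \<Rightarrow> real" where
  "qform X v = v \<bullet> (X *v v)"

definition pos_def :: "real ^ 'a ^ 'a \<Rightarrow> bool" where
  "pos_def X \<longleftrightarrow> transpose X = X \<and> (\<forall>v. v \<noteq> 0 \<longrightarrow> 0 < qform X v)"

definition neg_semidef :: "real ^ 'a ^ 'a \<Rightarrow> bool" where
  "neg_semidef X \<longleftrightarrow> transpose X = X \<and> (\<forall>v. qform X v \<le> 0)"

definition eigenvalues :: "real ^ 'a ^ 'a \<Rightarrow> real set" where
  "eigenvalues X = {l. \<exists>v. v \<noteq> 0 \<and> X *v v = l *\<^sub>R v}"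

text \<open>Intended for symmetric matrices only, whose set of eigenvalues is finite and nonempty.\<close>

definition lambda_max :: "real ^ 'a ^ 'a \<Rightarrow> real" where
  "lambda_max X = Max (eigenvalues X)"

definition lambda_min :: "real ^ 'a ^ 'a \<Rightarrow> real" where
  "lambda_min X = Min (eigenvalues X)"

text \<open>The arguments of \<open>block\<close> are, in this order, the upper left, upper right, lower left and
  lower right block; rows and columns of the result are indexed by sum types.\<close>

definition block ::
  "real ^ 'c ^ 'a \<Rightarrow> real ^ 'd ^ 'a \<Rightarrow> real ^ 'c ^ 'b \<Rightarrow> real ^ 'd ^ 'b
     \<Rightarrow> real ^ ('c::finite + 'd::finite) ^ ('a::finite + 'b::finite)" where
  "block X11 X12 X21 X22 = (\<chi> i j.
     case i of
       Inl a \<Rightarrow> (case j of Inl c \<Rightarrow> X11 $ a $ c | Inr d \<Rightarrow> X12 $ a $ d)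
     | Inr b \<Rightarrow> (case j of Inl c \<Rightarrow> X21 $ b $ c | Inr d \<Rightarrow> X22 $ b $ d))"


section \<open>Independence of two random variables\<close>

text \<open>The constant \<open>indep_var\<close> of the library requires both random variables to take values in
  the same type.\<close>

definition indep_rv ::
  "'w measure \<Rightarrow> 'a measure \<Rightarrow> ('w \<Rightarrow> 'a) \<Rightarrow> 'b measure \<Rightarrow> ('w \<Rightarrow> 'b) \<Rightarrow> bool" where
  "indep_rv \<Omega> S X T Y \<longleftrightarrow>
     X \<in> measurable \<Omega> S \<and> Y \<in> measurable \<Omega> T \<and>
     prob_space.indep_set \<Omega> {X -` U \<inter> space \<Omega> |U. U \<in> sets S} {Y -` U \<inter> space \<Omega> |U. U \<in> sets T}"

end

theory Submission
  imports Defs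
begin

text \<open>
  The certificate makes the energy

    \<open>W \<xi> = a0 * (f (E *v \<xi>) - f x_star) + qform P (\<xi> - \<xi>_star)\<close>

  contract by the factor \<open>\<rho>\<^sup>2\<close> in conditional expectation, at every state.  Write
  \<open>e = \<xi> - \<xi>_star\<close>, \<open>y = C *v \<xi>\<close>, \<open>x = E *v \<xi>\<close>, \<open>x'\<close> for the next value of \<open>x\<close>, and \<open>g\<close> for the
  gradient of \<open>f\<close> at \<open>y\<close>.  The decomposition

    \<open>f x' - f x_star = (f x' - f y) + \<rho>\<^sup>2 * (f y - f x) + (1 - \<rho>\<^sup>2) * (f y - f x_star)
      + \<rho>\<^sup>2 * (f x - f x_star)\<close>

  isolates three differences that are bounded by quadratic forms in \<open>(e, g)\<close>: the first one, in
  expectation over the noise, by the form of \<open>N1\<close> (\<open>descent_inequality\<close> and the bound on the second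
  moment of the noise through \<open>E ** B\<close>), the other two by the forms of \<open>N2\<close> and \<open>N3\<close>
  (\<open>strongly_convex_gradient_inequality\<close>).  The quadratic part of the energy exceeds
  \<open>\<rho>\<^sup>2\<close> times its previous value, in expectation, by at most the form of \<open>M0\<close>.  With the weights
  \<open>a0\<close>, \<open>a0 * \<rho>\<^sup>2\<close> and \<open>a0 * (1 - \<rho>\<^sup>2)\<close> of the three differences, these forms add up to that of
  \<open>T\<close>, which is nonpositive.

  The energy dominates \<open>lambda_min P' * (norm e)\<^sup>2\<close>: the quadratic growth of \<open>f\<close> around its minimizer
  contributes exactly the term by which \<open>P'\<close> exceeds \<open>P\<close>.  So \<open>W\<close> is nonnegative, although \<open>P\<close> may be
  indefinite.

  Nonnegativity allows the expected energies along the iteration to be compared as nonnegative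
  integrals, before the errors are known to be square integrable.  At a fixed state, the next energy
  lies below a random variable that is affine in the noisy gradient and in the two quadratic forms
  whose expectations are controlled, which gives the contraction there (\<open>expected_lyapunov_step\<close>).
  Independence turns the bound at fixed states into one along the iteration
  (\<open>nn_integral_geometric_decay\<close>), and the finite bound on the expected energy then yields the
  integrability of the squared errors.  Rayleigh quotients (\<open>qform_le_lambda_max\<close>,
  \<open>lambda_min_le_qform\<close>) translate between the energy, the error of the state and that of the output.
\<close>

section \<open>Gradient inequalities for smooth strongly convex functions\<close>

lemma GDERIV_grad:
  fixes f :: "'a::euclidean_space \<Rightarrow> real"
  assumes "f differentiable (at x)"
  shows "GDERIV f x :> grad f x"
proof -
  obtain f' where f': "(f has_derivative f') (at x)"
    using assms by (auto simp: differentiable_def)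
  then interpret linear f' by (rule has_derivative_linear)
  define D where "D = (\<Sum>b\<in>Basis. f' b *\<^sub>R b)"
  have "f' h = h \<bullet> D" for h
  proof -
    have "f' h = f' (\<Sum>b\<in>Basis. (h \<bullet> b) *\<^sub>R b)" by (simp add: euclidean_representation)
    also have "\<dots> = h \<bullet> D" by (simp add: sum scale D_def inner_sum_right mult.commute)
    finally show ?thesis .
  qed
  then have "f' = (\<lambda>h. h \<bullet> D)" by auto
  then have D: "GDERIV f x :> D" using f' by (simp add: gderiv_def)
  moreover have "D' = D" if "GDERIV f x :> D'" for D'
    using has_derivative_unique[OF D[unfolded gderiv_def] that[unfolded gderiv_def]]
    by (metis inner_commute vector_eq_rdot)
  ultimately show ?thesis unfolding grad_def by (rule theI)
qed

lemma DERIV_along_line: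
  fixes f :: "'a::euclidean_space \<Rightarrow> real"
  assumes "\<And>x. f differentiable (at x)"
  shows "((\<lambda>t. f (v + t *\<^sub>R h)) has_real_derivative grad f (v + t *\<^sub>R h) \<bullet> h) (at t)"
proof -
  have "(f has_derivative (\<lambda>k. k \<bullet> grad f (v + t *\<^sub>R h))) (at (v + t *\<^sub>R h))"
    using GDERIV_grad[OF assms] by (simp add: gderiv_def)
  moreover have "((\<lambda>t. v + t *\<^sub>R h) has_derivative (\<lambda>s. s *\<^sub>R h)) (at t)"
    by (auto intro!: derivative_eq_intros)
  ultimately have "((\<lambda>t. f (v + t *\<^sub>R h)) has_derivative (\<lambda>s. (s *\<^sub>R h) \<bullet> grad f (v + t *\<^sub>R h))) (at t)"
    using has_derivative_compose[of "\<lambda>t. v + t *\<^sub>R h" _ t UNIV f] by blast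
  then show ?thesis
    by (simp add: has_field_derivative_def inner_commute mult.commute[of _ "_ \<bullet> _"])
qed

text \<open>Along the segment from \<open>v\<close> to \<open>w\<close>, the difference \<open>p\<close> between \<open>f\<close> and the claimed quadratic
  upper bound is nonincreasing: Cauchy-Schwarz and the Lipschitz condition bound its derivative.\<close>

lemma descent_inequality:
  fixes f :: "'a::euclidean_space \<Rightarrow> real"
  assumes diff: "\<And>x. f differentiable (at x)" and lip: "L-lipschitz_on UNIV (grad f)"
  shows "f w \<le> f v + grad f v \<bullet> (w - v) + L / 2 * (norm (w - v))\<^sup>2"
proof -
  define h where "h = w - v"
  define p where "p t = f (v + t *\<^sub>R h) - t * (grad f v \<bullet> h) - L / 2 * t\<^sup>2 * (norm h)\<^sup>2" for t
  have "p 1 \<le> p 0"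
  proof (rule DERIV_nonpos_imp_nonincreasing[where f = p])
    fix t :: real assume t: "0 \<le> t" "t \<le> 1"
    let ?d = "grad f (v + t *\<^sub>R h) \<bullet> h - grad f v \<bullet> h - L * t * (norm h)\<^sup>2"
    have "(p has_real_derivative ?d) (at t)"
      unfolding p_def by (auto intro!: derivative_eq_intros DERIV_along_line diff)
    moreover have "?d \<le> 0"
    proof -
      have "(grad f (v + t *\<^sub>R h) - grad f v) \<bullet> h
          \<le> norm (grad f (v + t *\<^sub>R h) - grad f v) * norm h" by (rule norm_cauchy_schwarz)
      also have "\<dots> \<le> (L * (t * norm h)) * norm h"
        using lipschitz_onD[OF lip, of "v + t *\<^sub>R h" v] t
        by (intro mult_right_mono) (auto simp: dist_norm)
      finally show ?thesis by (simp add: inner_diff_left power2_eq_square mult_ac)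
    qed
    ultimately show "\<exists>d. (p has_real_derivative d) (at t) \<and> d \<le> 0" by blast
  qed simp
  then show ?thesis by (simp add: p_def h_def)
qed

text \<open>The defining inequality at the point \<open>v + t *\<^sub>R (w - v)\<close> can be divided by \<open>t\<close>; in the limit
  from the right at \<open>t = 0\<close> the difference quotient becomes the directional derivative.\<close>

lemma strongly_convex_gradient_inequality:
  fixes f :: "'a::euclidean_space \<Rightarrow> real"
  assumes diff: "\<And>x. f differentiable (at x)" and conv: "strongly_convex m f"
  shows "f v + grad f v \<bullet> (w - v) + m / 2 * (norm (w - v))\<^sup>2 \<le> f w"
proof -
  define h where "h = w - v"
  have "((\<lambda>t. (f (v + t *\<^sub>R h) - f v) / t) \<longlongrightarrow> grad f v \<bullet> h) (at_right 0)"
    using DERIV_along_line[OF diff, of v h 0]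
    by (auto simp: has_field_derivative_iff intro: filterlim_mono at_le)
  moreover have "((\<lambda>t::real. f w - f v - m / 2 * (1 - t) * (norm h)\<^sup>2)
      \<longlongrightarrow> f w - f v - m / 2 * (1 - 0) * (norm h)\<^sup>2) (at_right 0)"
    by (intro tendsto_intros)
  moreover have "\<forall>\<^sub>F t in at_right 0.
      (f (v + t *\<^sub>R h) - f v) / t \<le> f w - f v - m / 2 * (1 - t) * (norm h)\<^sup>2"
  proof -
    have "(f (v + t *\<^sub>R h) - f v) / t \<le> f w - f v - m / 2 * (1 - t) * (norm h)\<^sup>2"
      if t: "0 < t" "t < 1" for t
    proof -
      have "v + t *\<^sub>R h = t *\<^sub>R w + (1 - t) *\<^sub>R v" by (simp add: h_def algebra_simps)
      then have "f (v + t *\<^sub>R h) \<le> t * f w + (1 - t) * f v - m / 2 * t * (1 - t) * (norm h)\<^sup>2"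
        using conv t by (simp add: strongly_convex_def h_def)
      then have "f (v + t *\<^sub>R h) - f v \<le> (f w - f v - m / 2 * (1 - t) * (norm h)\<^sup>2) * t"
        by (simp add: algebra_simps)
      then show ?thesis using t by (simp add: pos_divide_le_eq)
    qed
    then show ?thesis by (auto intro!: eventually_at_rightI[of 0 1])
  qed
  ultimately have "grad f v \<bullet> h \<le> f w - f v - m / 2 * (1 - 0) * (norm h)\<^sup>2"
    by (intro tendsto_le[OF trivial_limit_at_right_real])
  then show ?thesis by (simp add: h_def)
qed

lemma strongly_convex_quadratic_growth:
  fixes f :: "'a::euclidean_space \<Rightarrow> real"
  assumes diff: "\<And>x. f differentiable (at x)" and conv: "strongly_convex m f"
    and min: "\<And>v. f c \<le> f v"
  shows "m / 2 * (norm (w - c))\<^sup>2 \<le> f w - f c"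
proof -
  have "(\<lambda>h. h \<bullet> grad f c) = (\<lambda>h. 0)"
    using GDERIV_grad[OF diff] min
    by (intro differential_zero_maxmin[of c UNIV f]) (auto simp: gderiv_def)
  then have "grad f c \<bullet> (w - c) = 0" by (metis inner_commute)
  then show ?thesis
    using strongly_convex_gradient_inequality[OF diff conv, of c w] by simp
qed

section \<open>Quadratic forms and extreme eigenvalues of symmetric matrices\<close>

lemma inner_transpose_mult:
  fixes X :: "real ^ 'a ^ 'b"
  shows "x \<bullet> (transpose X *v y) = (X *v x) \<bullet> y"
  by (metis dot_lmul_matrix inner_commute transpose_matrix_vector)

lemma qform_transpose_mult:
  fixes K :: "real ^ 'b ^ 'a"
  shows "qform (transpose K ** X ** K) v = qform X (K *v v)"
  by (simp add: qform_def inner_transpose_mult del: transpose_matrix_vector flip: matrix_vector_mul_assoc)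

lemma qform_gram:
  fixes K :: "real ^ 'b ^ 'a"
  shows "qform (transpose K ** K) v = (norm (K *v v))\<^sup>2"
  using qform_transpose_mult[of K "mat 1" v]
  by (simp add: qform_def power2_norm_eq_inner)

lemma qform_add: "qform (X + Y) v = qform X v + qform Y v"
  by (simp add: qform_def matrix_vector_mult_add_rdistrib inner_add_right)

lemma qform_scaleR: "qform (c *\<^sub>R X) v = c * qform X v"
  by (simp add: qform_def flip: scaleR_matrix_vector_assoc)

lemma inner_symmetric_matrix:
  fixes X :: "real ^ 'a ^ 'a"
  assumes "transpose X = X"
  shows "x \<bullet> (X *v y) = (X *v x) \<bullet> y"
  using inner_transpose_mult[of x X y] assms by simp

text \<open>Eigenvectors for distinct eigenvalues are orthogonal, hence linearly independent.\<close>

lemma finite_eigenvalues: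
  fixes X :: "real ^ 'a ^ 'a"
  assumes "transpose X = X"
  shows "finite (eigenvalues X)"
proof -
  define ev where "ev l = (SOME v. v \<noteq> 0 \<and> X *v v = l *\<^sub>R v)" for l
  have ev: "ev l \<noteq> 0" "X *v ev l = l *\<^sub>R ev l" if "l \<in> eigenvalues X" for l
    using someI_ex[of "\<lambda>v. v \<noteq> 0 \<and> X *v v = l *\<^sub>R v"] that
    by (auto simp: ev_def eigenvalues_def)
  have orth: "ev k \<bullet> ev l = 0" if "k \<in> eigenvalues X" "l \<in> eigenvalues X" "k \<noteq> l" for k l
    using inner_symmetric_matrix[OF assms, of "ev k" "ev l"] ev that by simp
  have inj: "inj_on ev (eigenvalues X)"
    by (rule inj_onI) (metis orth ev(1) inner_eq_zero_iff)
  have "pairwise orthogonal (ev ` eigenvalues X)"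
    by (auto simp: pairwise_def orthogonal_def) (metis orth)
  then have "independent (ev ` eigenvalues X)"
    using ev(1) by (intro pairwise_orthogonal_independent) force+
  then show ?thesis
    using inj finite_imageD independent_imp_finite by blast
qed

text \<open>The maximum \<open>l\<close> of the quadratic form over the unit sphere, attained at \<open>v\<close>, is an eigenvalue.
  The form \<open>l * (norm w)\<^sup>2 - qform X w\<close> is nonnegative and vanishes at \<open>v\<close>.  If the residual
  \<open>r = l *\<^sub>R v - X *v v\<close> were nonzero, a small step from \<open>v\<close> along \<open>- r\<close> would make it negative,
  since its first-order change in that direction is a negative multiple of \<open>r \<bullet> r\<close>.\<close>

lemma qform_bound_attained:
  fixes X :: "real ^ 'a ^ 'a"
  assumes sym: "transpose X = X"
  obtains l where "l \<in> eigenvalues X" "\<And>w. qform X w \<le> l * (norm w)\<^sup>2"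
proof -
  have "continuous_on (sphere 0 1) (qform X)"
    unfolding qform_def by (intro continuous_intros linear_continuous_on) auto
  moreover have "sphere (0 :: real ^ 'a) 1 \<noteq> {}" by simp
  ultimately obtain v where v: "norm v = 1" "\<And>w. norm w = 1 \<Longrightarrow> qform X w \<le> qform X v"
    using continuous_attains_sup[of "sphere 0 1" "qform X"] compact_sphere by auto
  define l where "l = qform X v"
  have bound: "qform X w \<le> l * (norm w)\<^sup>2" for w
  proof (cases "w = 0")
    case False
    have "qform X w = (norm w)\<^sup>2 * qform X (w /\<^sub>R norm w)"
      using False by (simp add: qform_def matrix_vector_mult_scaleR power2_eq_square field_simps)
    also have "\<dots> \<le> (norm w)\<^sup>2 * l"
      using v(2)[of "w /\<^sub>R norm w"] False by (intro mult_left_mono) (auto simp: l_def)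
    finally show ?thesis by (simp add: mult.commute)
  qed (simp add: qform_def)
  define r where "r = l *\<^sub>R v - X *v v"
  have "r = 0"
  proof (rule ccontr)
    assume "r \<noteq> 0"
    define c where "c = l * (norm r)\<^sup>2 - qform X r"
    have c: "0 \<le> c" using bound[of r] by (simp add: c_def)
    have vr: "v \<bullet> (X *v r) = r \<bullet> (X *v v)"
      using inner_symmetric_matrix[OF sym, of v r] by (simp add: inner_commute)
    have ineq: "0 \<le> t * (2 * (r \<bullet> r)) + t\<^sup>2 * c" for t
    proof -
      have "(norm (v + t *\<^sub>R r))\<^sup>2 = 1 + 2 * t * (r \<bullet> v) + t\<^sup>2 * (norm r)\<^sup>2"
        unfolding power2_norm_eq_inner using v(1)
        by (simp add: inner_simps norm_eq_1 inner_commute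
            power2_eq_square algebra_simps)
      moreover have "qform X (v + t *\<^sub>R r) = l + 2 * t * (r \<bullet> (X *v v)) + t\<^sup>2 * qform X r"
        using vr by (simp add: qform_def l_def matrix_vector_mult_scaleR matrix_vector_right_distrib
            inner_simps power2_eq_square algebra_simps)
      moreover have "r \<bullet> r = l * (r \<bullet> v) - r \<bullet> (X *v v)"
        by (subst (2) r_def) (simp add: inner_simps)
      then have "r \<bullet> (X *v v) = l * (r \<bullet> v) - r \<bullet> r" by simp
      ultimately have "l * (norm (v + t *\<^sub>R r))\<^sup>2 - qform X (v + t *\<^sub>R r)
          = t * (2 * (r \<bullet> r)) + t\<^sup>2 * c"
        by (simp add: c_def algebra_simps)
      then show ?thesis using bound[of "v + t *\<^sub>R r"] by simp
    qed
    have rr: "0 < r \<bullet> r" using \<open>r \<noteq> 0\<close> by simp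
    \<comment> \<open>The step length is taken proportional to \<open>1 / (c + 1)\<close>, so that the quadratic term, with
      coefficient \<open>c\<close>, cannot outweigh the linear one, even if \<open>c = 0\<close>.\<close>
    define t where "t = - (r \<bullet> r) / (c + 1)"
    have "r \<bullet> r = - t * (c + 1)" using c by (simp add: t_def)
    then have "t * (2 * (r \<bullet> r)) + t\<^sup>2 * c = - (t\<^sup>2 * (c + 2))"
      by (simp only:) (simp add: power2_eq_square algebra_simps)
    moreover have "0 < t\<^sup>2 * (c + 2)"
      using rr c by (intro mult_pos_pos) (auto simp: t_def)
    ultimately show False using ineq[of t] by linarith
  qed
  then have "l \<in> eigenvalues X"
    using v(1) by (auto simp: eigenvalues_def r_def intro!: exI[of _ v])
  then show ?thesis using bound that by blast
qed

lemma eigenvalues_uminus: "l \<in> eigenvalues (- X) \<longleftrightarrow> - l \<in> eigenvalues X"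
  for X :: "real ^ 'a ^ 'a"
proof -
  have "(- X) *v v = - (X *v v)" for v
    by (metis add_cancel_left_left add_eq_0_iff matrix_vector_mult_add_rdistrib matrix_vector_mult_0 ab_left_minus)
  then show ?thesis unfolding eigenvalues_def by (auto simp: minus_equation_iff eq_commute[of _ "- _"])
qed

lemma qform_le_lambda_max:
  fixes X :: "real ^ 'a ^ 'a"
  assumes "transpose X = X"
  shows "qform X w \<le> lambda_max X * (norm w)\<^sup>2"
proof -
  obtain l where l: "l \<in> eigenvalues X" "qform X w \<le> l * (norm w)\<^sup>2"
    using qform_bound_attained[OF assms] by metis
  then have "l \<le> lambda_max X"
    by (simp add: lambda_max_def finite_eigenvalues[OF assms])
  with l(2) show ?thesis by (meson mult_right_mono order_trans zero_le_power2)
qed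

lemma lambda_min_in_eigenvalues:
  fixes X :: "real ^ 'a ^ 'a"
  assumes "transpose X = X"
  shows "lambda_min X \<in> eigenvalues X"
proof -
  have "eigenvalues X \<noteq> {}" using qform_bound_attained[OF assms] by blast
  then show ?thesis
    by (simp add: lambda_min_def finite_eigenvalues[OF assms] Min_in)
qed

text \<open>The largest eigenvalue of \<open>- X\<close> bounds \<open>- qform X\<close> from above, and its negation is an
  eigenvalue of \<open>X\<close>.\<close>

lemma lambda_min_le_qform:
  fixes X :: "real ^ 'a ^ 'a"
  assumes "transpose X = X"
  shows "lambda_min X * (norm w)\<^sup>2 \<le> qform X w"
proof -
  have "transpose (- X) = - X"
    using assms by (simp add: transpose_def vec_eq_iff)
  then obtain l where l: "- l \<in> eigenvalues X" "qform (- X) w \<le> l * (norm w)\<^sup>2"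
    using qform_bound_attained[of "- X"] by (metis eigenvalues_uminus)
  have "lambda_min X \<le> - l"
    using l(1) by (simp add: lambda_min_def finite_eigenvalues[OF assms])
  moreover have "qform (- X) w = - qform X w"
    using qform_scaleR[of "-1" X w] by simp
  ultimately show ?thesis
    using l(2) mult_right_mono[of "lambda_min X" "- l" "(norm w)\<^sup>2"] by simp
qed

lemma lambda_min_pos:
  fixes X :: "real ^ 'a ^ 'a"
  assumes "pos_def X"
  shows "0 < lambda_min X"
proof -
  obtain v where v: "v \<noteq> 0" "X *v v = lambda_min X *\<^sub>R v"
    using lambda_min_in_eigenvalues[of X] assms by (auto simp: pos_def_def eigenvalues_def)
  then have "0 < lambda_min X * (v \<bullet> v)"
    using assms by (auto simp: pos_def_def qform_def)
  then show ?thesis using inner_ge_zero[of v] by (auto simp: zero_less_mult_iff)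
qed

lemma lambda_max_gram_nonneg:
  fixes K :: "real ^ 'b ^ 'a"
  shows "0 \<le> lambda_max (transpose K ** K)"
proof -
  obtain w :: "real ^ 'b" where w: "norm w = 1" using vector_choose_size[of 1] by auto
  have "0 \<le> qform (transpose K ** K) w" by (simp add: qform_gram)
  also have "\<dots> \<le> lambda_max (transpose K ** K) * (norm w)\<^sup>2"
    by (rule qform_le_lambda_max) (simp add: matrix_transpose_mul)
  finally show ?thesis using w by simp
qed

section \<open>Quadratic forms of block matrices\<close>

definition stack :: "real ^ 'a \<Rightarrow> real ^ 'b \<Rightarrow> real ^ ('a::finite + 'b::finite)" where
  "stack a b = (\<chi> i. case i of Inl j \<Rightarrow> a $ j | Inr j \<Rightarrow> b $ j)"

lemma sum_UNIV_Plus: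
  "(\<Sum>i\<in>(UNIV :: ('a::finite + 'b::finite) set). h i) = (\<Sum>i\<in>UNIV. h (Inl i)) + (\<Sum>i\<in>UNIV. h (Inr i))"
  for h :: "_ \<Rightarrow> 'c::comm_monoid_add"
  unfolding UNIV_Plus_UNIV[symmetric] by (subst sum.Plus) auto

lemma inner_stack: "stack a b \<bullet> stack c d = a \<bullet> c + b \<bullet> d"
  by (simp add: inner_vec_def sum_UNIV_Plus stack_def)

lemma block_mult_stack:
  "block X11 X12 X21 X22 *v stack a b = stack (X11 *v a + X12 *v b) (X21 *v a + X22 *v b)"
  by (simp add: vec_eq_iff matrix_vector_mult_def sum_UNIV_Plus stack_def block_def split: sum.split)

lemma transpose_block:
  "transpose (block X11 X12 X21 X22)
    = block (transpose X11) (transpose X21) (transpose X12) (transpose X22)"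
  by (simp add: transpose_def block_def vec_eq_iff split: sum.split)

lemma qform_block:
  "qform (block X11 X12 X21 X22) (stack a b)
     = a \<bullet> (X11 *v a) + a \<bullet> (X12 *v b) + b \<bullet> (X21 *v a) + b \<bullet> (X22 *v b)"
  by (simp add: qform_def block_mult_stack inner_stack inner_simps)

text \<open>The three kinds of blocks in the matrix inequality are evaluated at an error \<open>e\<close> and a gradient
  \<open>g\<close>.  The first one is the change of the quadratic energy \<open>qform P\<close> in a step \<open>A *v e + B *v g\<close> of the
  error, relative to the factor \<open>r\<close>, with the term that is quadratic in the gradient inflated by
  \<open>c\<close> to account for the noise.\<close>

lemma qform_lyapunov_block:
  fixes P A :: "real ^ 'n ^ 'n" and B :: "real ^ 'd ^ 'n"
  assumes "transpose P = P"
  shows "qform (block (transpose A ** P ** A - r *\<^sub>R P) (transpose A ** P ** B)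
                      (transpose B ** P ** A) (c *\<^sub>R (transpose B ** P ** B))) (stack e g)
       = qform P (A *v e) - r * qform P e + 2 * ((P *v (A *v e)) \<bullet> (B *v g))
         + c * qform (transpose B ** P ** B) g"
proof -
  have cross: "e \<bullet> ((transpose A ** P ** B) *v g) = (P *v (A *v e)) \<bullet> (B *v g)"
    "g \<bullet> ((transpose B ** P ** A) *v e) = (P *v (A *v e)) \<bullet> (B *v g)"
    using inner_symmetric_matrix[OF assms, of "A *v e" "B *v g"]
    by (simp_all add: inner_transpose_mult inner_commute del: transpose_matrix_vector
        flip: matrix_vector_mul_assoc)
  have "e \<bullet> ((transpose A ** P ** A - r *\<^sub>R P) *v e) = qform P (A *v e) - r * qform P e"
    by (simp add: qform_def inner_transpose_mult matrix_vector_mult_diff_rdistrib inner_diff_right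
        del: transpose_matrix_vector flip: matrix_vector_mul_assoc scaleR_matrix_vector_assoc)
  moreover have "g \<bullet> ((c *\<^sub>R (transpose B ** P ** B)) *v g) = c * qform (transpose B ** P ** B) g"
    by (simp add: qform_def flip: scaleR_matrix_vector_assoc)
  ultimately show ?thesis
    by (simp add: qform_block cross)
qed

text \<open>This is the right-hand side \<open>g \<bullet> s + L / 2 * (norm s)\<^sup>2\<close> of the descent inequality for the
  displacement \<open>s = D *v e + K *v g\<close>, with \<open>(norm (K *v g))\<^sup>2\<close> inflated by \<open>c\<close>.\<close>

lemma qform_smoothness_block:
  fixes D :: "real ^ 'n ^ 'd" and K :: "real ^ 'd ^ 'd"
  shows "qform (block ((L / 2) *\<^sub>R (transpose D ** D))
                      ((1 / 2) *\<^sub>R (transpose D ** (L *\<^sub>R K + mat 1)))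
                      ((1 / 2) *\<^sub>R (transpose (L *\<^sub>R K + mat 1) ** D))
                      ((L * c / 2) *\<^sub>R (transpose K ** K) + (1 / 2) *\<^sub>R (K + transpose K)))
           (stack e g)
       = g \<bullet> (D *v e) + g \<bullet> (K *v g)
         + L / 2 * ((norm (D *v e))\<^sup>2 + 2 * ((D *v e) \<bullet> (K *v g)) + c * (norm (K *v g))\<^sup>2)"
proof -
  have "(D *v e) \<bullet> ((L *\<^sub>R K + mat 1) *v g) = L * ((D *v e) \<bullet> (K *v g)) + g \<bullet> (D *v e)"
    by (simp add: matrix_vector_mult_add_rdistrib inner_add_right inner_commute
        flip: scaleR_matrix_vector_assoc)
  then have "e \<bullet> (((1 / 2) *\<^sub>R (transpose D ** (L *\<^sub>R K + mat 1))) *v g)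
      = (L * ((D *v e) \<bullet> (K *v g)) + g \<bullet> (D *v e)) / 2"
    and "g \<bullet> (((1 / 2) *\<^sub>R (transpose (L *\<^sub>R K + mat 1) ** D)) *v e)
      = (L * ((D *v e) \<bullet> (K *v g)) + g \<bullet> (D *v e)) / 2"
    by (simp_all add: inner_transpose_mult inner_commute del: transpose_matrix_vector
        flip: matrix_vector_mul_assoc scaleR_matrix_vector_assoc)
  moreover have "e \<bullet> (((L / 2) *\<^sub>R (transpose D ** D)) *v e) = L / 2 * (norm (D *v e))\<^sup>2"
    using qform_scaleR[of "L / 2" "transpose D ** D" e] unfolding qform_gram by (simp add: qform_def)
  moreover have "qform (transpose K) g = g \<bullet> (K *v g)"
    unfolding qform_def by (simp add: inner_transpose_mult inner_commute del: transpose_matrix_vector)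
  then have "g \<bullet> (((L * c / 2) *\<^sub>R (transpose K ** K) + (1 / 2) *\<^sub>R (K + transpose K)) *v g)
      = L * c / 2 * (norm (K *v g))\<^sup>2 + g \<bullet> (K *v g)"
    unfolding qform_def[symmetric] qform_add qform_scaleR qform_gram by (simp add: qform_def)
  ultimately show ?thesis
    by (simp add: qform_block algebra_simps)
qed

text \<open>This is the upper bound that strong convexity gives for \<open>f v - f (v - F *v e)\<close>, where \<open>g\<close> is the
  gradient at \<open>v\<close>.\<close>

lemma qform_sector_block:
  fixes F :: "real ^ 'n ^ 'd"
  shows "qform (transpose (block F 0 0 (mat 1 :: real ^ 'd ^ 'd))
           ** block (- (m / 2) *\<^sub>R (mat 1 :: real ^ 'd ^ 'd)) ((1 / 2) *\<^sub>R mat 1)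
                    ((1 / 2) *\<^sub>R mat 1) (0 :: real ^ 'd ^ 'd)
           ** block F 0 0 (mat 1 :: real ^ 'd ^ 'd)) (stack e g)
       = g \<bullet> (F *v e) - m / 2 * (norm (F *v e))\<^sup>2"
proof -
  have half: "(c *\<^sub>R mat 1 :: real ^ 'd ^ 'd) *v v = c *\<^sub>R v" for c v
    by (simp flip: scaleR_matrix_vector_assoc)
  show ?thesis
    unfolding qform_transpose_mult block_mult_stack
    by (simp only: qform_block half)
      (simp add: power2_norm_eq_inner inner_commute)
qed

section \<open>Integration against independent noise\<close>

text \<open>Independence is the product formula on rectangles, and these determine a product measure.\<close>

lemma indep_rv_distr:
  assumes "prob_space \<Omega>" and "indep_rv \<Omega> S X T Y"
  shows "distr \<Omega> (S \<Otimes>\<^sub>M T) (\<lambda>\<omega>. (X \<omega>, Y \<omega>)) = distr \<Omega> S X \<Otimes>\<^sub>M distr \<Omega> T Y"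
proof -
  interpret prob_space \<Omega> by fact
  have X [measurable]: "X \<in> measurable \<Omega> S" and Y [measurable]: "Y \<in> measurable \<Omega> T"
    and ind: "indep_set {X -` U \<inter> space \<Omega> |U. U \<in> sets S} {Y -` U \<inter> space \<Omega> |U. U \<in> sets T}"
    using assms(2) by (auto simp: indep_rv_def)
  interpret X: prob_space "distr \<Omega> S X" by (rule prob_space_distr) simp
  interpret Y: prob_space "distr \<Omega> T Y" by (rule prob_space_distr) simp
  show ?thesis
  proof (rule pair_measure_eqI[symmetric])
    fix U W assume "U \<in> sets (distr \<Omega> S X)" "W \<in> sets (distr \<Omega> T Y)"
    then have U [measurable]: "U \<in> sets S" and W [measurable]: "W \<in> sets T" by auto
    have "(\<lambda>\<omega>. (X \<omega>, Y \<omega>)) -` (U \<times> W) \<inter> space \<Omega> = (X -` U \<inter> space \<Omega>) \<inter> (Y -` W \<inter> space \<Omega>)"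
      by auto
    moreover have "prob ((X -` U \<inter> space \<Omega>) \<inter> (Y -` W \<inter> space \<Omega>))
        = prob (X -` U \<inter> space \<Omega>) * prob (Y -` W \<inter> space \<Omega>)"
      using U W by (intro indep_setD[OF ind]) blast+
    ultimately show "emeasure (distr \<Omega> S X) U * emeasure (distr \<Omega> T Y) W
        = emeasure (distr \<Omega> (S \<Otimes>\<^sub>M T) (\<lambda>\<omega>. (X \<omega>, Y \<omega>))) (U \<times> W)"
      by (simp add: emeasure_distr emeasure_eq_measure ennreal_mult)
  qed (auto intro: X.sigma_finite_measure_axioms Y.sigma_finite_measure_axioms)
qed

lemma nn_integral_indep_rv:
  assumes "prob_space \<Omega>" and "indep_rv \<Omega> S X T Y"
    and [measurable]: "h \<in> borel_measurable (S \<Otimes>\<^sub>M T)"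
  shows "(\<integral>\<^sup>+\<omega>. h (X \<omega>, Y \<omega>) \<partial>\<Omega>) = (\<integral>\<^sup>+\<omega>. (\<integral>\<^sup>+y. h (X \<omega>, y) \<partial>distr \<Omega> T Y) \<partial>\<Omega>)"
proof -
  interpret prob_space \<Omega> by fact
  have [measurable]: "X \<in> measurable \<Omega> S" "Y \<in> measurable \<Omega> T"
    using assms(2) by (auto simp: indep_rv_def)
  interpret Y: prob_space "distr \<Omega> T Y" by (rule prob_space_distr) simp
  have h: "h \<in> borel_measurable (distr \<Omega> S X \<Otimes>\<^sub>M distr \<Omega> T Y)" by simp
  have "(\<integral>\<^sup>+\<omega>. h (X \<omega>, Y \<omega>) \<partial>\<Omega>) = (\<integral>\<^sup>+p. h p \<partial>distr \<Omega> (S \<Otimes>\<^sub>M T) (\<lambda>\<omega>. (X \<omega>, Y \<omega>)))"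
    by (simp add: nn_integral_distr)
  also have "\<dots> = (\<integral>\<^sup>+x. (\<integral>\<^sup>+y. h (x, y) \<partial>distr \<Omega> T Y) \<partial>distr \<Omega> S X)"
    unfolding indep_rv_distr[OF assms(1,2)] by (rule Y.nn_integral_fst[OF h, symmetric])
  also have "\<dots> = (\<integral>\<^sup>+\<omega>. (\<integral>\<^sup>+y. h (X \<omega>, y) \<partial>distr \<Omega> T Y) \<partial>\<Omega>)"
    by (subst nn_integral_distr) (auto intro!: Y.borel_measurable_nn_integral)
  finally show ?thesis .
qed

text \<open>A nonnegative function whose expectation over fresh noise contracts at every fixed state
  contracts in expectation along the iteration, because the state is independent of the noise that
  drives the next step.\<close>

lemma nn_integral_geometric_decay:
  fixes W :: "'s::topological_space \<Rightarrow> real"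
  assumes \<Omega>: "prob_space \<Omega>"
    and z_law: "\<And>k. distr \<Omega> \<nu> (z k) = \<nu>"
    and z_indep: "\<And>k. indep_rv \<Omega> borel (\<xi> k) \<nu> (z k)"
    and init: "\<And>\<omega>. \<omega> \<in> space \<Omega> \<Longrightarrow> \<xi> 0 \<omega> = \<xi>0"
    and step: "\<And>k \<omega>. \<omega> \<in> space \<Omega> \<Longrightarrow> \<xi> (Suc k) \<omega> = \<Phi> (\<xi> k \<omega>, z k \<omega>)"
    and [measurable]: "\<Phi> \<in> borel \<Otimes>\<^sub>M \<nu> \<rightarrow>\<^sub>M borel" "W \<in> borel_measurable borel"
    and W: "\<And>v. 0 \<le> W v" and q: "0 \<le> q"
    and decay: "\<And>v. (\<integral>\<^sup>+\<zeta>. ennreal (W (\<Phi> (v, \<zeta>))) \<partial>\<nu>) \<le> ennreal (q * W v)"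
  shows "(\<integral>\<^sup>+\<omega>. ennreal (W (\<xi> k \<omega>)) \<partial>\<Omega>) \<le> ennreal (q ^ k * W \<xi>0)"
proof (induction k)
  case 0
  interpret prob_space \<Omega> by fact
  have "(\<integral>\<^sup>+\<omega>. ennreal (W (\<xi> 0 \<omega>)) \<partial>\<Omega>) = (\<integral>\<^sup>+\<omega>. ennreal (W \<xi>0) \<partial>\<Omega>)"
    by (intro nn_integral_cong) (simp add: init)
  then show ?case by (simp add: emeasure_space_1)
next
  case (Suc k)
  have [measurable]: "\<xi> k \<in> \<Omega> \<rightarrow>\<^sub>M borel" using z_indep[of k] by (simp add: indep_rv_def)
  have "(\<integral>\<^sup>+\<omega>. ennreal (W (\<xi> (Suc k) \<omega>)) \<partial>\<Omega>) = (\<integral>\<^sup>+\<omega>. ennreal (W (\<Phi> (\<xi> k \<omega>, z k \<omega>))) \<partial>\<Omega>)"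
    by (intro nn_integral_cong) (simp add: step)
  also have "\<dots> = (\<integral>\<^sup>+\<omega>. (\<integral>\<^sup>+\<zeta>. ennreal (W (\<Phi> (\<xi> k \<omega>, \<zeta>))) \<partial>distr \<Omega> \<nu> (z k)) \<partial>\<Omega>)"
    by (rule nn_integral_indep_rv[OF \<Omega> z_indep, where h = "\<lambda>p. ennreal (W (\<Phi> p))"]) measurable
  also have "\<dots> \<le> (\<integral>\<^sup>+\<omega>. ennreal q * ennreal (W (\<xi> k \<omega>)) \<partial>\<Omega>)"
    using decay by (intro nn_integral_mono) (simp add: z_law ennreal_mult q W)
  also have "\<dots> = ennreal q * (\<integral>\<^sup>+\<omega>. ennreal (W (\<xi> k \<omega>)) \<partial>\<Omega>)"
    by (rule nn_integral_cmult) measurable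
  also have "\<dots> \<le> ennreal q * ennreal (q ^ k * W \<xi>0)"
    by (intro mult_left_mono Suc.IH) simp
  finally show ?case by (simp add: ennreal_mult' q mult.assoc)
qed

section \<open>Expected decrease of the Lyapunov function\<close>

text \<open>The only inequality is in the quadratic terms; the affine part of a function of the noise
  depends on the mean alone.\<close>

lemma expectation_quadratic_le:
  fixes H :: "'z \<Rightarrow> 'v::euclidean_space"
  assumes "prob_space \<nu>"
    and H: "integrable \<nu> H" "(\<integral>\<zeta>. H \<zeta> \<partial>\<nu>) = g"
    and q: "integrable \<nu> (\<lambda>\<zeta>. q (H \<zeta>))" "(\<integral>\<zeta>. q (H \<zeta>) \<partial>\<nu>) \<le> r * q g"
    and q': "integrable \<nu> (\<lambda>\<zeta>. q' (H \<zeta>))" "(\<integral>\<zeta>. q' (H \<zeta>) \<partial>\<nu>) \<le> r * q' g"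
    and "0 \<le> \<alpha>"
  shows "integrable \<nu> (\<lambda>\<zeta>. c + p \<bullet> H \<zeta> + \<alpha> * q (H \<zeta>) + q' (H \<zeta>))"
    and "(\<integral>\<zeta>. c + p \<bullet> H \<zeta> + \<alpha> * q (H \<zeta>) + q' (H \<zeta>) \<partial>\<nu>) \<le> c + p \<bullet> g + \<alpha> * (r * q g) + r * q' g"
proof -
  interpret prob_space \<nu> by fact
  show "integrable \<nu> (\<lambda>\<zeta>. c + p \<bullet> H \<zeta> + \<alpha> * q (H \<zeta>) + q' (H \<zeta>))"
    using H q q' by simp
  have "(\<integral>\<zeta>. c + p \<bullet> H \<zeta> + \<alpha> * q (H \<zeta>) + q' (H \<zeta>) \<partial>\<nu>)
      = c + p \<bullet> g + \<alpha> * (\<integral>\<zeta>. q (H \<zeta>) \<partial>\<nu>) + (\<integral>\<zeta>. q' (H \<zeta>) \<partial>\<nu>)"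
    using H q(1) q'(1) by (simp add: prob_space)
  also have "\<dots> \<le> c + p \<bullet> g + \<alpha> * (r * q g) + r * q' g"
    using q(2) q'(2) \<open>0 \<le> \<alpha>\<close> by (intro add_mono mult_left_mono) auto
  finally show "(\<integral>\<zeta>. c + p \<bullet> H \<zeta> + \<alpha> * q (H \<zeta>) + q' (H \<zeta>) \<partial>\<nu>) \<le> c + p \<bullet> g + \<alpha> * (r * q g) + r * q' g" .
qed

text \<open>Here \<open>y + d\<close> and \<open>w\<close> are the parts of the next output and of the next error that the noisy
  gradient \<open>H\<close> does not influence; \<open>K\<close> and \<open>B\<close> carry the noise into the output and the error.
  By the descent inequality, the next energy is at most the function \<open>U\<close>, which is affine in \<open>H\<close> and
  in the two quadratic forms with controlled expectation.  Nonnegativity of the energy makes \<open>U\<close>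
  nonnegative, so that the Bochner integral of \<open>U\<close> is its nonnegative integral and bounds that of the energy.\<close>

lemma expected_lyapunov_step:
  fixes f :: "real ^ 'd \<Rightarrow> real" and H :: "'z \<Rightarrow> real ^ 'd"
    and P :: "real ^ 'n ^ 'n" and B :: "real ^ 'd ^ 'n" and K :: "real ^ 'd ^ 'd"
  assumes "prob_space \<nu>"
    and diff: "\<And>v. f differentiable (at v)" and lip: "L-lipschitz_on UNIV (grad f)"
    and P: "transpose P = P" and a: "0 \<le> a"
    and H: "integrable \<nu> H" "(\<integral>\<zeta>. H \<zeta> \<partial>\<nu>) = grad f y"
    and K: "integrable \<nu> (\<lambda>\<zeta>. qform (transpose K ** K) (H \<zeta>))"
      "(\<integral>\<zeta>. qform (transpose K ** K) (H \<zeta>) \<partial>\<nu>) \<le> r * qform (transpose K ** K) (grad f y)"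
    and B: "integrable \<nu> (\<lambda>\<zeta>. qform (transpose B ** P ** B) (H \<zeta>))"
      "(\<integral>\<zeta>. qform (transpose B ** P ** B) (H \<zeta>) \<partial>\<nu>) \<le> r * qform (transpose B ** P ** B) (grad f y)"
    and nonneg: "\<And>\<zeta>. 0 \<le> a * (f (y + d + K *v H \<zeta>) - c) + qform P (w + B *v H \<zeta>)"
  shows "(\<integral>\<^sup>+\<zeta>. ennreal (a * (f (y + d + K *v H \<zeta>) - c) + qform P (w + B *v H \<zeta>)) \<partial>\<nu>)
     \<le> ennreal (a * (f y - c + grad f y \<bullet> d + grad f y \<bullet> (K *v grad f y)
            + L / 2 * ((norm d)\<^sup>2 + 2 * (d \<bullet> (K *v grad f y)) + r * (norm (K *v grad f y))\<^sup>2))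
          + (qform P w + 2 * ((P *v w) \<bullet> (B *v grad f y)) + r * qform (transpose B ** P ** B) (grad f y)))"
    (is "(\<integral>\<^sup>+\<zeta>. ennreal (?W \<zeta>) \<partial>\<nu>) \<le> ennreal ?R")
proof -
  define g where "g = grad f y"
  define c' where "c' = a * (f y - c + g \<bullet> d + L / 2 * (norm d)\<^sup>2) + qform P w"
  \<comment> \<open>The vector of the linear part of \<open>U\<close>: adjoints collect the cross terms of the descent bound
    and of \<open>qform P\<close> into one inner product with \<open>H\<close>.\<close>
  define p where "p = transpose K *v (a *\<^sub>R (g + L *\<^sub>R d)) + transpose B *v (2 *\<^sub>R (P *v w))"
  define U where "U \<zeta> = c' + p \<bullet> H \<zeta> + (a * L / 2) * qform (transpose K ** K) (H \<zeta>)
      + qform (transpose B ** P ** B) (H \<zeta>)" for \<zeta>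
  have L: "0 \<le> L" using lip by (rule lipschitz_on_nonneg)
  have p: "p \<bullet> h = a * (g \<bullet> (K *v h) + L * (d \<bullet> (K *v h))) + 2 * ((P *v w) \<bullet> (B *v h))" for h
  proof -
    have "p \<bullet> h = h \<bullet> p" by (rule inner_commute)
    also have "\<dots> = a * (g \<bullet> (K *v h) + L * (d \<bullet> (K *v h))) + 2 * ((P *v w) \<bullet> (B *v h))"
      unfolding p_def inner_add_right inner_transpose_mult by (simp add: inner_simps inner_commute)
    finally show ?thesis .
  qed
  have WU: "?W \<zeta> \<le> U \<zeta>" for \<zeta>
  proof -
    let ?h = "H \<zeta>"
    have "f (y + d + K *v ?h) \<le> f y + g \<bullet> (d + K *v ?h) + L / 2 * (norm (d + K *v ?h))\<^sup>2"
      using descent_inequality[OF diff lip, of "y + d + K *v ?h" y] by (simp add: g_def add.assoc)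
    also have "(norm (d + K *v ?h))\<^sup>2 = (norm d)\<^sup>2 + 2 * (d \<bullet> (K *v ?h)) + (norm (K *v ?h))\<^sup>2"
      by (simp add: power2_norm_eq_inner inner_simps inner_commute)
    finally have "a * (f (y + d + K *v ?h) - c)
        \<le> a * (f y + g \<bullet> (d + K *v ?h) + L / 2 * ((norm d)\<^sup>2 + 2 * (d \<bullet> (K *v ?h)) + (norm (K *v ?h))\<^sup>2) - c)"
      using a by (intro mult_left_mono) auto
    moreover have "qform P (w + B *v ?h)
        = qform P w + 2 * ((P *v w) \<bullet> (B *v ?h)) + qform (transpose B ** P ** B) ?h"
      using inner_symmetric_matrix[OF P, of w "B *v ?h"]
      unfolding qform_transpose_mult
      by (simp add: qform_def matrix_vector_right_distrib inner_simps inner_commute)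
    ultimately show ?thesis
      by (simp add: U_def p c'_def qform_gram inner_add_right algebra_simps)
  qed
  have U: "integrable \<nu> U"
    and le: "(\<integral>\<zeta>. U \<zeta> \<partial>\<nu>) \<le> c' + p \<bullet> g + (a * L / 2) * (r * qform (transpose K ** K) g)
      + r * qform (transpose B ** P ** B) g"
    using expectation_quadratic_le[where \<alpha> = "a * L / 2" and c = c' and p = p
        and q = "qform (transpose K ** K)" and q' = "qform (transpose B ** P ** B)",
        OF \<open>prob_space \<nu>\<close> H K B] a L
    unfolding U_def g_def by simp_all
  have "(\<integral>\<^sup>+\<zeta>. ennreal (?W \<zeta>) \<partial>\<nu>) \<le> (\<integral>\<^sup>+\<zeta>. ennreal (U \<zeta>) \<partial>\<nu>)"
    by (intro nn_integral_mono ennreal_leI WU)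
  also have "\<dots> = ennreal (\<integral>\<zeta>. U \<zeta> \<partial>\<nu>)"
    using U order_trans[OF nonneg WU] by (intro nn_integral_eq_integral) auto
  also have "\<dots> \<le> ennreal ?R"
    using le by (intro ennreal_leI) (simp add: c'_def p qform_gram g_def[symmetric] algebra_simps)
  finally show ?thesis .
qed

section \<open>Geometric mean-square convergence\<close>

theorem theorem6p1:
  fixes f :: "real ^ 'd \<Rightarrow> real" and m L :: real and x_star :: "real ^ 'd"
    and A :: "real ^ 'n ^ 'n" and B :: "real ^ 'd ^ 'n" and C E :: "real ^ 'n ^ 'd"
    and \<nu> :: "'z measure" and G :: "real ^ 'd \<Rightarrow> 'z \<Rightarrow> real ^ 'd"
    and \<Omega> :: "'w measure" and z :: "nat \<Rightarrow> 'w \<Rightarrow> 'z"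
    and \<xi> :: "nat \<Rightarrow> 'w \<Rightarrow> real ^ 'n" and u y x :: "nat \<Rightarrow> 'w \<Rightarrow> real ^ 'd"
    and \<xi>0 \<xi>_star :: "real ^ 'n"
    and a0 \<rho> \<rho>0 :: real and P P' :: "real ^ 'n ^ 'n"
    and T M0 M1 M2 N1 N2 N3 :: "real ^ ('n + 'd) ^ ('n + 'd)"
    and V :: "nat \<Rightarrow> real ^ 'n \<Rightarrow> real"
  assumes mL: "0 < m" "m \<le> L"
    and f: "f \<in> smooth_strongly_convex m L"
    and minimizer: "\<forall>v. f x_star \<le> f v"
    and dim: "CARD('d) \<le> CARD('n)"
    \<comment> \<open>the random gradient: noise law \<open>\<nu>\<close>, unbiasedness\<close>
    and noise: "prob_space \<nu>"
    and G_meas: "case_prod G \<in> borel_measurable (borel \<Otimes>\<^sub>M \<nu>)"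
    and unbiased: "\<forall>v. integrable \<nu> (G v) \<and> (\<integral>\<zeta>. G v \<zeta> \<partial>\<nu>) = grad f v"
    \<comment> \<open>the random iteration\<close>
    and \<Omega>: "prob_space \<Omega>"
    and z_law: "\<forall>k. z k \<in> measurable \<Omega> \<nu> \<and> distr \<Omega> \<nu> (z k) = \<nu>"
    and z_indep: "\<forall>k. indep_rv \<Omega> borel (\<xi> k) \<nu> (z k)"
    and xi_0: "\<forall>\<omega>\<in>space \<Omega>. \<xi> 0 \<omega> = \<xi>0"
    and xi_Suc: "\<forall>k. \<forall>\<omega>\<in>space \<Omega>. \<xi> (Suc k) \<omega> = A *v \<xi> k \<omega> + B *v u k \<omega>"
    and u: "\<forall>k. \<forall>\<omega>\<in>space \<Omega>. u k \<omega> = G (y k \<omega>) (z k \<omega>)"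
    and y: "\<forall>k. \<forall>\<omega>\<in>space \<Omega>. y k \<omega> = C *v \<xi> k \<omega>"
    and x: "\<forall>k. \<forall>\<omega>\<in>space \<Omega>. x k \<omega> = E *v \<xi> k \<omega>"
    and xi_star: "A *v \<xi>_star = \<xi>_star" "C *v \<xi>_star = x_star" "E *v \<xi>_star = x_star"
    \<comment> \<open>the certificate\<close>
    and a0: "0 < a0" and \<rho>: "0 < \<rho>" "\<rho> < 1" and \<rho>0: "1 < \<rho>0"
    and P_sym: "transpose P = P"
    and P': "P' = P + (a0 * m / 2) *\<^sub>R (transpose E ** E)" "pos_def P'"
    and bound_EB: "\<forall>v. integrable \<nu> (\<lambda>\<zeta>. qform (transpose (E ** B) ** (E ** B)) (G v \<zeta>)) \<and>
           (\<integral>\<zeta>. qform (transpose (E ** B) ** (E ** B)) (G v \<zeta>) \<partial>\<nu>)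
             \<le> \<rho>0 * qform (transpose (E ** B) ** (E ** B)) (grad f v)"
    and bound_BPB: "\<forall>v. integrable \<nu> (\<lambda>\<zeta>. qform (transpose B ** P ** B) (G v \<zeta>)) \<and>
           (\<integral>\<zeta>. qform (transpose B ** P ** B) (G v \<zeta>) \<partial>\<nu>)
             \<le> \<rho>0 * qform (transpose B ** P ** B) (grad f v)"
    and M0: "M0 = block (transpose A ** P ** A - \<rho>\<^sup>2 *\<^sub>R P)  (transpose A ** P ** B)
                        (transpose B ** P ** A)           (\<rho>0 *\<^sub>R (transpose B ** P ** B))"
    and N1: "N1 = block
           ((L / 2) *\<^sub>R (transpose (E ** A - C) ** (E ** A - C)))
           ((1 / 2) *\<^sub>R (transpose (E ** A - C) ** (L *\<^sub>R (E ** B) + mat 1)))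
           ((1 / 2) *\<^sub>R (transpose (L *\<^sub>R (E ** B) + mat 1) ** (E ** A - C)))
           ((L * \<rho>0 / 2) *\<^sub>R (transpose (E ** B) ** (E ** B))
              + (1 / 2) *\<^sub>R (E ** B + transpose (E ** B)))"
    and N2: "N2 = transpose (block (C - E) 0 0 (mat 1 :: real ^ 'd ^ 'd))
           ** block (- (m / 2) *\<^sub>R (mat 1 :: real ^ 'd ^ 'd)) ((1 / 2) *\<^sub>R mat 1)
                    ((1 / 2) *\<^sub>R mat 1)                      (0 :: real ^ 'd ^ 'd)
           ** block (C - E) 0 0 (mat 1 :: real ^ 'd ^ 'd)"
    and N3: "N3 = block (transpose C) 0 0 (mat 1 :: real ^ 'd ^ 'd)
           ** block (- (m / 2) *\<^sub>R (mat 1 :: real ^ 'd ^ 'd)) ((1 / 2) *\<^sub>R mat 1)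
                    ((1 / 2) *\<^sub>R mat 1)                      (0 :: real ^ 'd ^ 'd)
           ** block C 0 0 (mat 1 :: real ^ 'd ^ 'd)"
    and M1: "M1 = N1 + N2"
    and M2: "M2 = N1 + N3"
    and T: "T = M0 + (a0 * \<rho>\<^sup>2) *\<^sub>R M1 + (a0 * (1 - \<rho>\<^sup>2)) *\<^sub>R M2"
    and LMI: "neg_semidef T"
    and V: "\<forall>k v. V k v = \<rho> powi (- 2 * int k) *
              (a0 * (f (E *v v) - f x_star) + qform P (v - \<xi>_star))"
  shows "\<forall>k. integrable \<Omega> (\<lambda>\<omega>. (norm (x k \<omega> - x_star))\<^sup>2)
           \<and> integrable \<Omega> (\<lambda>\<omega>. (norm (\<xi> k \<omega> - \<xi>_star))\<^sup>2)
           \<and> (\<integral>\<omega>. (norm (x k \<omega> - x_star))\<^sup>2 \<partial>\<Omega>)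
               \<le> lambda_max (transpose E ** E) * (\<integral>\<omega>. (norm (\<xi> k \<omega> - \<xi>_star))\<^sup>2 \<partial>\<Omega>)
           \<and> lambda_max (transpose E ** E) * (\<integral>\<omega>. (norm (\<xi> k \<omega> - \<xi>_star))\<^sup>2 \<partial>\<Omega>)
               \<le> lambda_max (transpose E ** E) / lambda_min P' * V 0 \<xi>0 * \<rho> ^ (2 * k)"
proof -
  have diff: "\<And>v. f differentiable (at v)" and conv: "strongly_convex m f"
    and lip: "L-lipschitz_on UNIV (grad f)"
    using f by (auto simp: smooth_strongly_convex_def)
  define W where "W v = a0 * (f (E *v v) - f x_star) + qform P (v - \<xi>_star)" for v
  have err: "X *v v - X *v \<xi>_star = X *v (v - \<xi>_star)" for X :: "real ^ 'n ^ 'b" and v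
    by (simp add: matrix_vector_mult_diff_distrib)
  have W_lower: "lambda_min P' * (norm (v - \<xi>_star))\<^sup>2 \<le> W v" for v
  proof -
    have "lambda_min P' * (norm (v - \<xi>_star))\<^sup>2 \<le> qform P' (v - \<xi>_star)"
      using P'(2) by (intro lambda_min_le_qform) (simp add: pos_def_def)
    also have "\<dots> = a0 * (m / 2 * (norm (E *v v - x_star))\<^sup>2) + qform P (v - \<xi>_star)"
      unfolding P'(1) qform_add qform_scaleR qform_gram
      by (simp add: xi_star(3) flip: err)
    also have "\<dots> \<le> W v"
      unfolding W_def using a0 minimizer
      by (intro add_mono mult_left_mono strongly_convex_quadratic_growth[OF diff conv]) auto
    finally show ?thesis .
  qed
  have lmin: "0 < lambda_min P'" using P'(2) by (rule lambda_min_pos)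
  have W_nonneg: "0 \<le> W v" for v
    using lmin by (intro order_trans[OF _ W_lower]) simp
  define \<Phi> where "\<Phi> = (\<lambda>(v, \<zeta>). A *v v + B *v G (C *v v) \<zeta>)"
  have decay: "(\<integral>\<^sup>+\<zeta>. ennreal (W (\<Phi> (v, \<zeta>))) \<partial>\<nu>) \<le> ennreal (\<rho>\<^sup>2 * W v)" for v
  proof -
    define e where "e = v - \<xi>_star"
    define g where "g = grad f (C *v v)"
    define d where "d = (E ** A - C) *v e"
    have d: "d = E *v (A *v v) - C *v v"
      unfolding d_def e_def
      by (simp add: matrix_vector_mult_diff_rdistrib matrix_vector_mult_diff_distrib xi_star
          flip: matrix_vector_mul_assoc)
    \<comment> \<open>The fixed point equations make \<open>C *v v + d\<close> and \<open>A *v e\<close> the noise-free parts of the next output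
      and of the next error.\<close>
    have W_\<Phi>: "W (\<Phi> (v, \<zeta>)) = a0 * (f (C *v v + d + (E ** B) *v G (C *v v) \<zeta>) - f x_star)
        + qform P (A *v e + B *v G (C *v v) \<zeta>)" for \<zeta>
      by (simp add: W_def \<Phi>_def d e_def matrix_vector_mult_diff_distrib matrix_vector_right_distrib
          xi_star algebra_simps flip: matrix_vector_mul_assoc)
    have "(\<integral>\<^sup>+\<zeta>. ennreal (W (\<Phi> (v, \<zeta>))) \<partial>\<nu>)
        \<le> ennreal (a0 * (f (C *v v) - f x_star + g \<bullet> d + g \<bullet> ((E ** B) *v g)
            + L / 2 * ((norm d)\<^sup>2 + 2 * (d \<bullet> ((E ** B) *v g)) + \<rho>0 * (norm ((E ** B) *v g))\<^sup>2))
          + (qform P (A *v e) + 2 * ((P *v (A *v e)) \<bullet> (B *v g))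
            + \<rho>0 * qform (transpose B ** P ** B) g))"
      using unbiased bound_EB bound_BPB W_nonneg a0
      unfolding W_\<Phi> g_def
      by (intro expected_lyapunov_step[OF noise diff lip P_sym]) (auto simp: W_\<Phi>[symmetric])
    also have "\<dots> \<le> ennreal (\<rho>\<^sup>2 * W v)"
    proof (rule ennreal_leI)
      have N1': "qform N1 (stack e g) = g \<bullet> d + g \<bullet> ((E ** B) *v g)
          + L / 2 * ((norm d)\<^sup>2 + 2 * (d \<bullet> ((E ** B) *v g)) + \<rho>0 * (norm ((E ** B) *v g))\<^sup>2)"
        unfolding N1 d_def by (rule qform_smoothness_block)
      have N2': "f (C *v v) - f (E *v v) \<le> qform N2 (stack e g)"
      proof -
        have "(C - E) *v e = C *v v - E *v v"
          by (simp add: e_def matrix_vector_mult_diff_rdistrib matrix_vector_mult_diff_distrib xi_star)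
        then show ?thesis
          using strongly_convex_gradient_inequality[OF diff conv, of "C *v v" "E *v v"]
          unfolding N2 qform_sector_block
          by (simp add: g_def inner_diff_right norm_minus_commute)
      qed
      have N3': "f (C *v v) - f x_star \<le> qform N3 (stack e g)"
      proof -
        have "C *v e = C *v v - x_star"
          by (simp add: e_def matrix_vector_mult_diff_distrib xi_star)
        moreover have "qform N3 (stack e g) = g \<bullet> (C *v e) - m / 2 * (norm (C *v e))\<^sup>2"
        proof -
          have zero: "transpose (0 :: real ^ 'a::finite ^ 'b::finite) = 0"
            by (simp add: transpose_def vec_eq_iff)
          have "block (transpose C) 0 0 (mat 1 :: real ^ 'd ^ 'd) = transpose (block C 0 0 (mat 1))"
            by (simp add: transpose_block zero)
          then show ?thesis unfolding N3 by (simp only: qform_sector_block)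
        qed
        ultimately show ?thesis
          using strongly_convex_gradient_inequality[OF diff conv, of "C *v v" x_star]
          by (simp add: g_def inner_diff_right norm_minus_commute)
      qed
      have M0': "qform M0 (stack e g) = qform P (A *v e) - \<rho>\<^sup>2 * qform P e
          + 2 * ((P *v (A *v e)) \<bullet> (B *v g)) + \<rho>0 * qform (transpose B ** P ** B) g"
        unfolding M0 by (rule qform_lyapunov_block[OF P_sym])
      have "\<rho>\<^sup>2 \<le> 1" using \<rho> by (simp add: power_le_one)
      then have "a0 * \<rho>\<^sup>2 * (f (C *v v) - f (E *v v)) \<le> a0 * \<rho>\<^sup>2 * qform N2 (stack e g)"
        and "a0 * (1 - \<rho>\<^sup>2) * (f (C *v v) - f x_star) \<le> a0 * (1 - \<rho>\<^sup>2) * qform N3 (stack e g)"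
        using a0 N2' N3' by (auto intro!: mult_left_mono)
      moreover have "qform T (stack e g) \<le> 0" using LMI by (simp add: neg_semidef_def)
      then have "qform M0 (stack e g) + a0 * qform N1 (stack e g)
          + a0 * \<rho>\<^sup>2 * qform N2 (stack e g) + a0 * (1 - \<rho>\<^sup>2) * qform N3 (stack e g) \<le> 0"
        unfolding T M1 M2 qform_add qform_scaleR by (simp add: algebra_simps)
      ultimately show "a0 * (f (C *v v) - f x_star + g \<bullet> d + g \<bullet> ((E ** B) *v g)
            + L / 2 * ((norm d)\<^sup>2 + 2 * (d \<bullet> ((E ** B) *v g)) + \<rho>0 * (norm ((E ** B) *v g))\<^sup>2))
          + (qform P (A *v e) + 2 * ((P *v (A *v e)) \<bullet> (B *v g))
            + \<rho>0 * qform (transpose B ** P ** B) g) \<le> \<rho>\<^sup>2 * W v"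
        unfolding M0' N1' W_def e_def[symmetric] by (simp add: algebra_simps)
    qed
    finally show ?thesis .
  qed
  have f_cont: "continuous_on UNIV f"
    using diff by (simp add: differentiable_imp_continuous_within continuous_at_imp_continuous_on)
  have f_meas [measurable]: "f \<in> borel_measurable borel"
    using f_cont by (rule borel_measurable_continuous_onI)
  have mult_meas [measurable]: "(\<lambda>v. X *v v) \<in> borel_measurable borel"
    for X :: "real ^ 'a::finite ^ 'b::finite"
    by (intro borel_measurable_continuous_onI linear_continuous_on) simp
  have W_meas: "W \<in> borel_measurable borel"
    unfolding W_def qform_def by measurable
  have \<Phi>_meas: "\<Phi> \<in> borel \<Otimes>\<^sub>M \<nu> \<rightarrow>\<^sub>M borel"
  proof -
    have "(\<lambda>p. case_prod G (C *v fst p, snd p)) \<in> borel_measurable (borel \<Otimes>\<^sub>M \<nu>)"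
      by (rule measurable_compose[OF _ G_meas]) measurable
    then have [measurable]: "(\<lambda>p. G (C *v fst p) (snd p)) \<in> borel_measurable (borel \<Otimes>\<^sub>M \<nu>)"
      by simp
    show ?thesis unfolding \<Phi>_def case_prod_beta by measurable
  qed
  have W_decay: "(\<integral>\<^sup>+\<omega>. ennreal (W (\<xi> k \<omega>)) \<partial>\<Omega>) \<le> ennreal ((\<rho>\<^sup>2) ^ k * W \<xi>0)" for k
    using z_law z_indep xi_0 xi_Suc u y
    by (intro nn_integral_geometric_decay[OF \<Omega>, where \<nu> = \<nu> and z = z and \<Phi> = \<Phi>]
        \<Phi>_meas W_meas W_nonneg decay) (auto simp: \<Phi>_def)
  have "integrable \<Omega> (\<lambda>\<omega>. (norm (x k \<omega> - x_star))\<^sup>2)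
           \<and> integrable \<Omega> (\<lambda>\<omega>. (norm (\<xi> k \<omega> - \<xi>_star))\<^sup>2)
           \<and> (\<integral>\<omega>. (norm (x k \<omega> - x_star))\<^sup>2 \<partial>\<Omega>)
               \<le> lambda_max (transpose E ** E) * (\<integral>\<omega>. (norm (\<xi> k \<omega> - \<xi>_star))\<^sup>2 \<partial>\<Omega>)
           \<and> lambda_max (transpose E ** E) * (\<integral>\<omega>. (norm (\<xi> k \<omega> - \<xi>_star))\<^sup>2 \<partial>\<Omega>)
               \<le> lambda_max (transpose E ** E) / lambda_min P' * V 0 \<xi>0 * \<rho> ^ (2 * k)" for k
  proof -
    let ?lmax = "lambda_max (transpose E ** E)"
    let ?R = "(\<rho>\<^sup>2) ^ k * W \<xi>0 / lambda_min P'"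
    have [measurable]: "\<xi> k \<in> \<Omega> \<rightarrow>\<^sub>M borel" using z_indep by (simp add: indep_rv_def)
    have R: "0 \<le> ?R" using W_nonneg lmin by simp
    have "(\<integral>\<^sup>+\<omega>. ennreal ((norm (\<xi> k \<omega> - \<xi>_star))\<^sup>2) \<partial>\<Omega>)
        \<le> (\<integral>\<^sup>+\<omega>. ennreal (1 / lambda_min P') * ennreal (W (\<xi> k \<omega>)) \<partial>\<Omega>)"
      using W_lower lmin W_nonneg
      by (intro nn_integral_mono)
        (simp add: ennreal_mult'[symmetric] pos_le_divide_eq mult.commute)
    also have "\<dots> = ennreal (1 / lambda_min P') * (\<integral>\<^sup>+\<omega>. ennreal (W (\<xi> k \<omega>)) \<partial>\<Omega>)"
      by (intro nn_integral_cmult measurable_compose[OF _ measurable_ennreal]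
          measurable_compose[OF _ W_meas]) measurable
    also have "\<dots> \<le> ennreal (1 / lambda_min P') * ennreal ((\<rho>\<^sup>2) ^ k * W \<xi>0)"
      by (intro mult_left_mono W_decay) simp
    also have "\<dots> = ennreal ?R"
      using lmin by (simp add: ennreal_mult'[symmetric])
    finally have bound: "(\<integral>\<^sup>+\<omega>. ennreal ((norm (\<xi> k \<omega> - \<xi>_star))\<^sup>2) \<partial>\<Omega>) \<le> ennreal ?R" .
    have int_xi: "integrable \<Omega> (\<lambda>\<omega>. (norm (\<xi> k \<omega> - \<xi>_star))\<^sup>2)"
      using le_less_trans[OF bound ennreal_less_top]
      by (intro integrableI_nonneg) auto
    have le_R: "(\<integral>\<omega>. (norm (\<xi> k \<omega> - \<xi>_star))\<^sup>2 \<partial>\<Omega>) \<le> ?R"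
      by (rule integral_real_bounded[OF R bound])
    have x_err: "(norm (x k \<omega> - x_star))\<^sup>2 = (norm (E *v (\<xi> k \<omega> - \<xi>_star)))\<^sup>2"
      if "\<omega> \<in> space \<Omega>" for \<omega>
      using x that by (simp add: xi_star flip: err)
    have E_le: "(norm (E *v (\<xi> k \<omega> - \<xi>_star)))\<^sup>2 \<le> ?lmax * (norm (\<xi> k \<omega> - \<xi>_star))\<^sup>2" for \<omega>
      unfolding qform_gram[symmetric] by (rule qform_le_lambda_max) (simp add: matrix_transpose_mul)
    have int_x: "integrable \<Omega> (\<lambda>\<omega>. (norm (x k \<omega> - x_star))\<^sup>2)"
    proof -
      have "integrable \<Omega> (\<lambda>\<omega>. (norm (E *v (\<xi> k \<omega> - \<xi>_star)))\<^sup>2)"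
        using E_le order_trans[OF zero_le_power2 E_le]
        by (intro Bochner_Integration.integrable_bound[OF integrable_mult_right[OF int_xi, of ?lmax]]) auto
      then show ?thesis by (subst Bochner_Integration.integrable_cong[OF refl x_err]) auto
    qed
    have "(\<integral>\<omega>. (norm (x k \<omega> - x_star))\<^sup>2 \<partial>\<Omega>) \<le> (\<integral>\<omega>. ?lmax * (norm (\<xi> k \<omega> - \<xi>_star))\<^sup>2 \<partial>\<Omega>)"
      using int_x int_xi E_le by (intro integral_mono) (auto simp: x_err)
    then have x_le: "(\<integral>\<omega>. (norm (x k \<omega> - x_star))\<^sup>2 \<partial>\<Omega>)
        \<le> ?lmax * (\<integral>\<omega>. (norm (\<xi> k \<omega> - \<xi>_star))\<^sup>2 \<partial>\<Omega>)" by simp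
    have "?lmax * (\<integral>\<omega>. (norm (\<xi> k \<omega> - \<xi>_star))\<^sup>2 \<partial>\<Omega>) \<le> ?lmax * ?R"
      by (intro mult_left_mono le_R lambda_max_gram_nonneg)
    also have "\<dots> = ?lmax / lambda_min P' * V 0 \<xi>0 * \<rho> ^ (2 * k)"
      using V by (simp add: W_def power_mult)
    finally show ?thesis using int_x int_xi x_le by blast
  qed
  then show ?thesis by blast
qed

end
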